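(* Let $\mathcal{S}=\{1,\dots,k\}$ be a finite state space, where $k\geq 1$ is an integer, and let $\kappa=(\kappa_{zs})_{z,s\in\mathcal{S}}$ be an aperiodic stochastic matrix with invariant distribution $\pi=(\pi_s)_{s\in\mathcal{S}}$. Then $\lim_{n\to\infty}(\kappa^n)_{zs}=\pi_s$ for all $z,s\in\mathcal{S}$.
   Context: A stochastic matrix is a square real matrix with non-negative entries whose rows each sum to one. $\kappa^n$ denotes the $n$-fold matrix product of $\kappa$, and $(\kappa^n)_{zs}$ its entry in row $z$ and column $s$. A distribution over $\mathcal{S}$ is a (column) vector $\pi\in[0,1]^k$ with $\sum_{s\in\mathcal{S}}\pi_s=1$. A distribution $\pi$ is an invariant distribution of $\kappa$ if $\pi^t\kappa=\pi^t$, where $t$ denotes transposition. The matrix $\kappa$ is called aperiodic if there exists an $N\in\mathbb{N}$ such that $(\kappa^n)_{zs}>0$ for all $n>N$ and all $z,s\in\mathcal{S}$ (a single $N$ for all pairs; this is the paper's definition of aperiodicity, and it implies irreducibility). *)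

theory Defs
  imports Complex_Main "Jordan_Normal_Form.Matrix"
begin

text \<open>The states \<open>1, \<dots>, k\<close> are numbered \<open>0, \<dots>, k - 1\<close>,
  following the indexing of matrices and vectors in the library.\<close>

definition stochastic_matrix :: "nat \<Rightarrow> real mat \<Rightarrow> bool" where
  "stochastic_matrix k \<kappa> \<longleftrightarrow>
     \<kappa> \<in> carrier_mat k k \<and>
     (\<forall>z<k. \<forall>s<k. 0 \<le> \<kappa> $$ (z, s)) \<and>
     (\<forall>z<k. (\<Sum>s<k. \<kappa> $$ (z, s)) = 1)"

definition distribution :: "nat \<Rightarrow> real vec \<Rightarrow> bool" where
  "distribution k \<pi> \<longleftrightarrow>
     \<pi> \<in> carrier_vec k \<and>
     (\<forall>s<k. \<pi> $ s \<in> {0..1}) \<and>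
     (\<Sum>s<k. \<pi> $ s) = 1"

definition invariant_distribution :: "nat \<Rightarrow> real mat \<Rightarrow> real vec \<Rightarrow> bool" where
  "invariant_distribution k \<kappa> \<pi> \<longleftrightarrow>
     distribution k \<pi> \<and> mat_of_row \<pi> * \<kappa> = mat_of_row \<pi>"

text \<open>The bound \<open>N\<close> is uniform over all pairs of states, so this notion includes irreducibility;
  it is not the condition that the return times of each state have greatest common divisor one.\<close>

definition aperiodic :: "nat \<Rightarrow> real mat \<Rightarrow> bool" where
  "aperiodic k \<kappa> \<longleftrightarrow>
     (\<exists>N::nat. \<forall>n>N. \<forall>z<k. \<forall>s<k. (\<kappa> ^\<^sub>m n) $$ (z, s) > 0)"

end

theory Submission
  imports Defs
begin

text \<open>The proof is Doeblin's contraction argument. By aperiodicity some power \<open>Q = \<kappa>\<^sup>M\<close> has only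
  positive entries, so there is a constant \<open>c \<in> (0, 1]\<close> with \<open>Q\<^sub>z\<^sub>y \<ge> c \<pi>\<^sub>y\<close> for all \<open>z, y\<close>:
  whatever the starting state, a fixed fraction \<open>c\<close> of the mass has reached equilibrium after \<open>M\<close>
  steps. Fix a column \<open>s\<close> and let \<open>f z = (\<kappa>\<^sup>n)\<^sub>z\<^sub>s - \<pi>\<^sub>s\<close> be the deviation from
  equilibrium. Invariance of \<open>\<pi>\<close> gives \<open>\<Sum>\<^sub>y \<pi>\<^sub>y f y = 0\<close>, so in passing from \<open>n\<close> to \<open>n + M\<close>
  the matrix \<open>Q\<close> may be replaced by \<open>Q\<^sub>z\<^sub>y - c \<pi>\<^sub>y\<close>, which is non-negative with row sums
  \<open>1 - c\<close>. Hence every \<open>M\<close> steps shrink the uniform deviation by the factor \<open>1 - c\<close>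
  (\<open>minorized_deviation_contracts\<close>), and the deviation at time \<open>n\<close> is at most
  \<open>(1 - c)\<^bsup>n div M\<^esup>\<close> (\<open>geometric_convergence\<close>).\<close>

lemma pow_mat_Suc_entry:
  assumes "\<kappa> \<in> carrier_mat k k" "z < k" "s < k"
  shows "(\<kappa> ^\<^sub>m Suc n) $$ (z, s) = (\<Sum>y<k. (\<kappa> ^\<^sub>m n) $$ (z, y) * \<kappa> $$ (y, s))"
  using assms pow_carrier_mat[OF assms(1), of n]
  by (auto simp: scalar_prod_def atLeast0LessThan)

lemma pow_mat_add_entry:
  fixes \<kappa> :: "'a :: semiring_1 mat"
  assumes "\<kappa> \<in> carrier_mat k k" "z < k" "s < k"
  shows "(\<kappa> ^\<^sub>m (m + n)) $$ (z, s) = (\<Sum>y<k. (\<kappa> ^\<^sub>m m) $$ (z, y) * (\<kappa> ^\<^sub>m n) $$ (y, s))"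
proof -
  have "\<kappa> ^\<^sub>m (m + n) = \<kappa> ^\<^sub>m m * \<kappa> ^\<^sub>m n"
  proof (induction n)
    case 0
    show ?case
      using pow_carrier_mat[OF assms(1), of m] assms(1) by simp
  next
    case (Suc n)
    then show ?case
      using assoc_mult_mat[OF pow_carrier_mat[OF assms(1), of m]
          pow_carrier_mat[OF assms(1), of n] assms(1)] by simp
  qed
  then show ?thesis
    using assms pow_carrier_mat[OF assms(1), of n] pow_carrier_mat[OF assms(1), of m]
    by (auto simp: scalar_prod_def atLeast0LessThan)
qed

lemma stochastic_matrix_pow:
  assumes "stochastic_matrix k \<kappa>"
  shows "stochastic_matrix k (\<kappa> ^\<^sub>m n)"
proof -
  have \<kappa>: "\<kappa> \<in> carrier_mat k k"
    using assms by (simp add: stochastic_matrix_def)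
  show ?thesis
  proof (induction n)
    case 0
    show ?case
      using \<kappa> by (auto simp: stochastic_matrix_def)
  next
    case (Suc n)
    have row: "(\<Sum>s<k. (\<kappa> ^\<^sub>m Suc n) $$ (z, s)) = 1" if z: "z < k" for z
    proof -
      have "(\<Sum>s<k. (\<kappa> ^\<^sub>m Suc n) $$ (z, s))
          = (\<Sum>s<k. \<Sum>y<k. (\<kappa> ^\<^sub>m n) $$ (z, y) * \<kappa> $$ (y, s))"
        by (intro sum.cong refl pow_mat_Suc_entry[OF \<kappa> z]) simp
      also have "\<dots> = (\<Sum>y<k. (\<kappa> ^\<^sub>m n) $$ (z, y) * (\<Sum>s<k. \<kappa> $$ (y, s)))"
        unfolding sum_distrib_left by (rule sum.swap)
      also have "\<dots> = (\<Sum>y<k. (\<kappa> ^\<^sub>m n) $$ (z, y))"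
        using assms by (intro sum.cong) (auto simp: stochastic_matrix_def)
      finally show ?thesis
        using Suc z by (simp add: stochastic_matrix_def)
    qed
    have nonneg: "0 \<le> (\<kappa> ^\<^sub>m Suc n) $$ (z, s)" if "z < k" "s < k" for z s
      using Suc assms that unfolding pow_mat_Suc_entry[OF \<kappa> that]
      by (intro sum_nonneg) (auto simp: stochastic_matrix_def)
    show ?case
      unfolding stochastic_matrix_def
      using row nonneg pow_carrier_mat[OF \<kappa>, of "Suc n"] by blast
  qed
qed

lemma stochastic_matrix_entry_le_1:
  assumes "stochastic_matrix k \<kappa>" "z < k" "s < k"
  shows "\<kappa> $$ (z, s) \<le> 1"
proof -
  have "\<kappa> $$ (z, s) \<le> (\<Sum>s<k. \<kappa> $$ (z, s))"
    by (rule member_le_sum) (use assms in \<open>auto simp: stochastic_matrix_def\<close>)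
  then show ?thesis
    using assms by (simp add: stochastic_matrix_def)
qed

lemma invariant_distribution_pow:
  assumes "\<kappa> \<in> carrier_mat k k" "invariant_distribution k \<kappa> \<pi>" "s < k"
  shows "(\<Sum>z<k. \<pi> $ z * (\<kappa> ^\<^sub>m n) $$ (z, s)) = \<pi> $ s"
  using assms(3)
proof (induction n arbitrary: s)
  case 0
  have "(\<Sum>z<k. \<pi> $ z * (\<kappa> ^\<^sub>m 0) $$ (z, s)) = (\<Sum>z<k. if z = s then \<pi> $ z else 0)"
    using assms(1) 0 by (intro sum.cong) auto
  then show ?case
    using 0 by simp
next
  case (Suc n)
  have "(\<Sum>z<k. \<pi> $ z * (\<kappa> ^\<^sub>m Suc n) $$ (z, s))
      = (\<Sum>z<k. \<Sum>y<k. \<pi> $ z * (\<kappa> ^\<^sub>m n) $$ (z, y) * \<kappa> $$ (y, s))"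
    using pow_mat_Suc_entry[OF assms(1) _ Suc.prems, of _ n]
    by (intro sum.cong) (auto simp: sum_distrib_left mult.assoc simp del: pow_mat.simps)
  also have "\<dots> = (\<Sum>y<k. (\<Sum>z<k. \<pi> $ z * (\<kappa> ^\<^sub>m n) $$ (z, y)) * \<kappa> $$ (y, s))"
    unfolding sum_distrib_right by (rule sum.swap)
  also have "\<dots> = (\<Sum>y<k. \<pi> $ y * \<kappa> $$ (y, s))"
    using Suc.IH by (intro sum.cong) auto
  also have "\<dots> = (mat_of_row \<pi> * \<kappa>) $$ (0, s)"
  proof -
    have "\<pi> \<in> carrier_vec k"
      using assms(2) by (simp add: invariant_distribution_def distribution_def)
    then show ?thesis
      using assms(1) Suc.prems by (auto simp: scalar_prod_def atLeast0LessThan)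
  qed
  also have "\<dots> = \<pi> $ s"
    using assms Suc.prems by (auto simp: invariant_distribution_def distribution_def)
  finally show ?case .
qed

text \<open>Since \<open>\<pi>\<close> annihilates \<open>f\<close>, subtracting \<open>c \<pi>\<close> from every row of \<open>Q\<close> leaves \<open>Q f\<close> unchanged;
  the part of \<open>Q\<close> that remains is non-negative and has row sums \<open>1 - c\<close>.\<close>

lemma minorized_deviation_contracts:
  fixes f :: "nat \<Rightarrow> real"
  assumes Q: "stochastic_matrix k Q"
    and \<pi>: "distribution k \<pi>"
    and minor: "\<And>y. y < k \<Longrightarrow> c * \<pi> $ y \<le> Q $$ (z, y)"
    and f0: "(\<Sum>y<k. \<pi> $ y * f y) = 0"
    and f: "\<And>y. y < k \<Longrightarrow> \<bar>f y\<bar> \<le> b"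
    and z: "z < k"
  shows "\<bar>\<Sum>y<k. Q $$ (z, y) * f y\<bar> \<le> (1 - c) * b"
proof -
  have "(\<Sum>y<k. Q $$ (z, y) * f y)
      = (\<Sum>y<k. Q $$ (z, y) * f y) - c * (\<Sum>y<k. \<pi> $ y * f y)"
    using f0 by simp
  also have "\<dots> = (\<Sum>y<k. (Q $$ (z, y) - c * \<pi> $ y) * f y)"
    by (simp add: left_diff_distrib sum_subtractf sum_distrib_left mult.assoc)
  also have "\<bar>\<dots>\<bar> \<le> (\<Sum>y<k. (Q $$ (z, y) - c * \<pi> $ y) * b)"
    using minor f by (intro order_trans[OF sum_abs] sum_mono) (auto simp: abs_mult intro!: mult_mono)
  also have "\<dots> = (1 - c) * b"
    using Q \<pi> z
    by (simp add: stochastic_matrix_def distribution_def sum_subtractf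
        flip: sum_distrib_left sum_distrib_right)
  finally show ?thesis .
qed

lemma geometric_convergence:
  assumes \<kappa>: "stochastic_matrix k \<kappa>"
    and inv: "invariant_distribution k \<kappa> \<pi>"
    and minor: "\<And>z y. z < k \<Longrightarrow> y < k \<Longrightarrow> c * \<pi> $ y \<le> (\<kappa> ^\<^sub>m M) $$ (z, y)"
    and z: "z < k" and s: "s < k"
  shows "\<bar>(\<kappa> ^\<^sub>m n) $$ (z, s) - \<pi> $ s\<bar> \<le> (1 - c) ^ (n div M)"
proof -
  have carrier: "\<kappa> \<in> carrier_mat k k"
    using \<kappa> by (simp add: stochastic_matrix_def)
  have \<pi>: "distribution k \<pi>"
    using inv by (simp add: invariant_distribution_def)
  have "\<bar>(\<kappa> ^\<^sub>m (j * M + r)) $$ (z, s) - \<pi> $ s\<bar> \<le> (1 - c) ^ j" for j r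
    using z
  proof (induction j arbitrary: z)
    case 0
    have "0 \<le> (\<kappa> ^\<^sub>m r) $$ (z, s)" "(\<kappa> ^\<^sub>m r) $$ (z, s) \<le> 1"
      using stochastic_matrix_pow[OF \<kappa>, of r] 0 s
      by (auto simp: stochastic_matrix_def intro: stochastic_matrix_entry_le_1)
    moreover have "0 \<le> \<pi> $ s" "\<pi> $ s \<le> 1"
      using \<pi> s by (auto simp: distribution_def)
    ultimately show ?case
      by simp
  next
    case (Suc j)
    define f where "f y = (\<kappa> ^\<^sub>m (j * M + r)) $$ (y, s) - \<pi> $ s" for y
    have Q: "stochastic_matrix k (\<kappa> ^\<^sub>m M)"
      by (rule stochastic_matrix_pow[OF \<kappa>])
    have f0: "(\<Sum>y<k. \<pi> $ y * f y) = 0"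
      using invariant_distribution_pow[OF carrier inv s, of "j * M + r"] \<pi>
      by (simp add: f_def distribution_def right_diff_distrib sum_subtractf
          flip: sum_distrib_right)
    have "(\<kappa> ^\<^sub>m (Suc j * M + r)) $$ (z, s) - \<pi> $ s = (\<Sum>y<k. (\<kappa> ^\<^sub>m M) $$ (z, y) * f y)"
      using pow_mat_add_entry[OF carrier Suc.prems s, of M "j * M + r"] Q Suc.prems
      by (simp add: f_def stochastic_matrix_def right_diff_distrib sum_subtractf add.assoc
          flip: sum_distrib_right)
    also have "\<bar>\<dots>\<bar> \<le> (1 - c) * (1 - c) ^ j"
      using Suc.IH Suc.prems minor
      by (intro minorized_deviation_contracts[OF Q \<pi> _ f0]) (auto simp: f_def)
    finally show ?case
      by simp
  qed
  from this[of "n div M" "n mod M"] show ?thesis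
    by simp
qed

text \<open>The smallest entry of a positive power serves as minorization constant, because \<open>\<pi>\<^sub>y \<le> 1\<close>.\<close>

lemma aperiodic_minorization:
  assumes k: "k \<ge> 1"
    and \<kappa>: "stochastic_matrix k \<kappa>"
    and ap: "aperiodic k \<kappa>"
    and \<pi>: "distribution k \<pi>"
  obtains M c where "M > 0" "0 < c" "c \<le> 1"
    "\<And>z y. z < k \<Longrightarrow> y < k \<Longrightarrow> c * \<pi> $ y \<le> (\<kappa> ^\<^sub>m M) $$ (z, y)"
proof -
  obtain N where N: "\<And>n z s. n > N \<Longrightarrow> z < k \<Longrightarrow> s < k \<Longrightarrow> (\<kappa> ^\<^sub>m n) $$ (z, s) > 0"
    using ap unfolding aperiodic_def by blast
  define Q where "Q = \<kappa> ^\<^sub>m Suc N"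
  define E where "E = (\<lambda>(z, y). Q $$ (z, y)) ` ({..<k} \<times> {..<k})"
  have E: "finite E" "E \<noteq> {}"
    using k by (auto simp: E_def lessThan_empty_iff)
  have c_le: "Min E \<le> Q $$ (z, y)" if "z < k" "y < k" for z y
    using E that by (intro Min_le) (auto simp: E_def)
  show thesis
  proof (rule that[of "Suc N" "Min E"])
    show pos: "0 < Min E"
      using E N[of "Suc N"] by (auto simp: E_def Q_def simp del: pow_mat.simps)
    show "Min E * \<pi> $ y \<le> (\<kappa> ^\<^sub>m Suc N) $$ (z, y)" if "z < k" "y < k" for z y
    proof -
      have "Min E * \<pi> $ y \<le> Min E"
        using \<pi> that pos by (simp add: distribution_def mult_left_le)
      also have "\<dots> \<le> Q $$ (z, y)"
        by (rule c_le[OF that])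
      finally show ?thesis
        by (simp only: Q_def)
    qed
    have "Min E \<le> Q $$ (0, 0)"
      using k by (intro c_le) auto
    also have "\<dots> \<le> 1"
      unfolding Q_def
      by (rule stochastic_matrix_entry_le_1[OF stochastic_matrix_pow[OF \<kappa>]]) (use k in auto)
    finally show "Min E \<le> 1" .
  qed simp
qed

theorem theorem1:
  fixes k :: nat and \<kappa> :: "real mat" and \<pi> :: "real vec"
  assumes "k \<ge> 1"
    and "stochastic_matrix k \<kappa>"
    and "aperiodic k \<kappa>"
    and "invariant_distribution k \<kappa> \<pi>"
  shows "\<forall>z<k. \<forall>s<k. (\<lambda>n. (\<kappa> ^\<^sub>m n) $$ (z, s)) \<longlonglongrightarrow> \<pi> $ s"
proof (intro allI impI)
  fix z s
  assume zs: "z < k" "s < k"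
  have "distribution k \<pi>"
    using assms(4) by (simp add: invariant_distribution_def)
  from aperiodic_minorization[OF assms(1-3) this] obtain M c
    where M: "M > 0" and c: "0 < c" "c \<le> 1"
      and minor: "\<And>z y. z < k \<Longrightarrow> y < k \<Longrightarrow> c * \<pi> $ y \<le> (\<kappa> ^\<^sub>m M) $$ (z, y)"
    by blast
  have div_at_top: "filterlim (\<lambda>n. n div M) at_top sequentially"
    unfolding filterlim_at_top
  proof
    fix K :: nat
    have "K \<le> n div M" if "n \<ge> K * M" for n
      using M that by (simp add: less_eq_div_iff_mult_less_eq)
    then show "\<forall>\<^sub>F n in sequentially. K \<le> n div M"
      unfolding eventually_sequentially by blast
  qed
  have "(\<lambda>n. (1 - c) ^ (n div M)) \<longlonglongrightarrow> 0"
    by (rule filterlim_compose[OF LIMSEQ_power_zero div_at_top]) (use c in auto)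
  then have "(\<lambda>n. (\<kappa> ^\<^sub>m n) $$ (z, s) - \<pi> $ s) \<longlonglongrightarrow> 0"
    by (rule tendsto_0_le[where K = 1])
      (use geometric_convergence[OF assms(2,4) minor zs] c in simp)
  then show "(\<lambda>n. (\<kappa> ^\<^sub>m n) $$ (z, s)) \<longlonglongrightarrow> \<pi> $ s"
    by (rule LIM_zero_cancel)
qed

end
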